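(* Let $n>3$ be odd and $m<n$ a positive integer with $\gcd(m,n)=\gcd(m-1,n)=1$. Then the only $p$-Sylow neutrosophic subloops of $\langle L_n(m)\cup I\rangle$ are $2$-Sylow ones; that is, if $p$ is a prime dividing $n+1$ for which a $p$-Sylow neutrosophic subloop of $\langle L_n(m)\cup I\rangle$ exists, then $p=2$.
   Context: For $n>3$ odd and $m<n$ a positive integer with $\gcd(m,n)=\gcd(m-1,n)=1$, the loop $L_n(m)$ is the set $\{e,1,2,\dots,n\}$ with operation: $e\cdot i=i\cdot e=i$ for all $i$; $i\cdot i=e$ for all $i$; and for $i,j\in\{1,\dots,n\}$, $i\neq j$, $i\cdot j$ is the element $s\in\{1,\dots,n\}$ with $s\equiv mj-(m-1)i \pmod n$. The neutrosophic loop $\langle L_n(m)\cup I\rangle$ is the set $\{e,1,\dots,n,eI,1I,\dots,nI\}$ of $2(n+1)$ distinct symbols, with the product of $L_n(m)$ on $\{e,1,\dots,n\}$ and $x\cdot(yI)=(xI)\cdot y=(xI)\cdot(yI)=(x\cdot y)I$ for $x,y\in L_n(m)$. A neutrosophic subloop is a subset of the form $P\cup\{xI:x\in P\}$, where $P$ is a subloop of $L_n(m)$. The order is the number of elements. For a prime $p$ with $n+1=p^kr$, $k\ge1$, $\gcd(p,r)=1$, a $p$-Sylow neutrosophic subloop means a neutrosophic subloop of order $2p^k$. *)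

theory Defs
  imports "HOL-Algebra.Group" "HOL-Computational_Algebra.Primes" "HOL-Number_Theory.Cong"
begin

text \<open>
  Loops are possibly non-associative, so only the record type of \<^theory>\<open>HOL-Algebra.Group\<close>
  (carrier, product, identity) is reused here, not its monoid axioms.
\<close>

locale algebraic_loop =
  fixes G (structure)
  assumes closed: "\<lbrakk>x \<in> carrier G; y \<in> carrier G\<rbrakk> \<Longrightarrow> x \<otimes> y \<in> carrier G"
    and one_closed: "\<one> \<in> carrier G"
    and l_one: "x \<in> carrier G \<Longrightarrow> \<one> \<otimes> x = x"
    and r_one: "x \<in> carrier G \<Longrightarrow> x \<otimes> \<one> = x"
    and l_div: "\<lbrakk>a \<in> carrier G; b \<in> carrier G\<rbrakk> \<Longrightarrow> \<exists>!x. x \<in> carrier G \<and> a \<otimes> x = b"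
    and r_div: "\<lbrakk>a \<in> carrier G; b \<in> carrier G\<rbrakk> \<Longrightarrow> \<exists>!y. y \<in> carrier G \<and> y \<otimes> a = b"

definition subloop :: "'a set \<Rightarrow> ('a, 'b) monoid_scheme \<Rightarrow> bool" where
  "subloop P G \<longleftrightarrow> P \<subseteq> carrier G \<and> algebraic_loop (G\<lparr>carrier := P\<rparr>)"

text \<open>
  The symbols \<open>e, 1, 2, \<dots>\<close>.  The product is total on this type; only its values on the
  carrier of \<open>L n m\<close> matter.
\<close>

datatype sym = E | Num nat

fun L_mult :: "nat \<Rightarrow> nat \<Rightarrow> sym \<Rightarrow> sym \<Rightarrow> sym" where
  "L_mult n m E y = y"
| "L_mult n m x E = x"
| "L_mult n m (Num i) (Num j) =
    (if i = j then E
     else Num (THE s. s \<in> {1..n} \<and>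
                 [int s = int m * int j - (int m - 1) * int i] (mod int n)))"

definition L :: "nat \<Rightarrow> nat \<Rightarrow> sym monoid" where
  "L n m = \<lparr>carrier = insert E (Num ` {1..n}), monoid.mult = L_mult n m, one = E\<rparr>"

text \<open>\<open>Pure x\<close> stands for \<open>x\<close> and \<open>Indet x\<close> for \<open>xI\<close>.\<close>

datatype 'a neutro = Pure 'a | Indet 'a

definition with_I :: "'a set \<Rightarrow> 'a neutro set" where
  "with_I P = Pure ` P \<union> Indet ` P"

fun neutro_mult :: "('a \<Rightarrow> 'a \<Rightarrow> 'a) \<Rightarrow> 'a neutro \<Rightarrow> 'a neutro \<Rightarrow> 'a neutro" where
  "neutro_mult f (Pure x) (Pure y) = Pure (f x y)"
| "neutro_mult f (Pure x) (Indet y) = Indet (f x y)"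
| "neutro_mult f (Indet x) (Pure y) = Indet (f x y)"
| "neutro_mult f (Indet x) (Indet y) = Indet (f x y)"

definition neutro_loop :: "('a, 'b) monoid_scheme \<Rightarrow> 'a neutro monoid" where
  "neutro_loop G =
    \<lparr>carrier = with_I (carrier G), monoid.mult = neutro_mult (monoid.mult G), one = Pure (one G)\<rparr>"

definition neutro_subloop :: "'a neutro set \<Rightarrow> ('a, 'b) monoid_scheme \<Rightarrow> bool" where
  "neutro_subloop Q G \<longleftrightarrow>
    Q \<subseteq> carrier (neutro_loop G) \<and> (\<exists>P. subloop P G \<and> Q = with_I P)"

definition sylow_neutro_subloop :: "nat \<Rightarrow> nat \<Rightarrow> nat \<Rightarrow> sym neutro set \<Rightarrow> bool" where
  "sylow_neutro_subloop p n m Q \<longleftrightarrow>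
    prime p \<and> neutro_subloop Q (L n m) \<and>
    (\<exists>k r. n + 1 = p ^ k * r \<and> k \<ge> 1 \<and> gcd p r = 1 \<and> card Q = 2 * p ^ k)"

end

theory Submission
  imports Defs "HOL-Number_Theory.Residues" "HOL-Library.Z2" "HOL-Library.Disjoint_Sets"
begin

text \<open>
  A neutrosophic subloop of order \<open>2 p^k\<close> is \<open>with_I P\<close> for a subloop \<open>P\<close> of order \<open>p^k\<close>, so it is
  enough to show that every subloop \<open>P\<close> of \<open>L n m\<close> other than \<open>{E}\<close> has even order.

  Let \<open>S\<close> be the set of the numbers in \<open>P\<close>, read as residues modulo \<open>n\<close>.  Off the diagonal the product
  is the affine operation \<open>i + m (j - i)\<close>, and on the diagonal that expression is just \<open>i\<close>; hence \<open>S\<close> is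
  closed under it without exception.  Both \<open>m\<close> and \<open>1 - m\<close> are units modulo \<open>n\<close>, and this forces \<open>S\<close> to be
  a coset of a subgroup of the integers modulo \<open>n\<close> (\<open>affine_closed_add\<close>, \<open>affine_closed_minus\<close>).  In
  particular \<open>S\<close> is invariant under the reflection \<open>i \<mapsto> 2 c - i\<close> through any of its points \<open>c\<close>.  As \<open>n\<close> is
  odd, \<open>c\<close> is the only fixed point, so \<open>S\<close> has odd size (\<open>odd_card_if_affine_closed\<close>), and
  \<open>card P = card S + 1\<close> is even.
\<close>

section \<open>Sets of residues closed under an affine operation\<close>

lemma euler_theorem_int:
  fixes u :: int
  assumes "n > 1" "coprime u (int n)"
  shows "[u ^ totient n = 1] (mod int n)"
proof -
  interpret residues "int n" "residue_ring (int n)"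
    using assms(1) by unfold_locales auto
  show ?thesis
    using euler_theorem[OF assms(2)] by simp
qed

text \<open>
  A set of residues modulo \<open>n\<close> is represented by the \<open>n\<close>-periodic set of all integers in these classes.
  The point \<open>0\<close> turns the affine operation into the two dilations by \<open>m\<close> and \<open>1 - m\<close>.
\<close>

locale affine_closed =
  fixes n :: nat and m :: int and T :: "int set"
  assumes n_gt_1: "n > 1"
    and coprime_m: "coprime m (int n)"
    and coprime_1_minus_m: "coprime (1 - m) (int n)"
    and periodic: "\<lbrakk>x \<in> T; [x = y] (mod int n)\<rbrakk> \<Longrightarrow> y \<in> T"
    and zero_mem: "0 \<in> T"
    and affine_mem: "\<lbrakk>x \<in> T; y \<in> T\<rbrakk> \<Longrightarrow> m * y + (1 - m) * x \<in> T"
begin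

lemma power_dilation_mem:
  assumes "x \<in> T"
  shows "m ^ k * x \<in> T" "(1 - m) ^ k * x \<in> T"
proof -
  show "m ^ k * x \<in> T"
  proof (induction k)
    case (Suc k)
    then show ?case
      using affine_mem[OF zero_mem Suc] by (simp add: mult.assoc)
  qed (use assms in simp)
  show "(1 - m) ^ k * x \<in> T"
  proof (induction k)
    case (Suc k)
    then show ?case
      using affine_mem[OF Suc zero_mem] by (simp add: mult.assoc)
  qed (use assms in simp)
qed

text \<open>
  The dilations have finite order by Euler's theorem, so their inverses are powers of them and preserve
  \<open>T\<close> too.  Undoing them in advance turns the affine operation into addition.
\<close>

lemma affine_closed_add:
  assumes "x \<in> T" "y \<in> T"
  shows "x + y \<in> T"
proof -
  define k where "k = totient n"
  have k: "k = Suc (k - 1)"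
    using n_gt_1 by (simp add: k_def)
  have "m * (m ^ (k - 1) * y) + (1 - m) * ((1 - m) ^ (k - 1) * x) \<in> T"
    using assms by (intro affine_mem power_dilation_mem)
  also have "m * (m ^ (k - 1) * y) + (1 - m) * ((1 - m) ^ (k - 1) * x) = m ^ k * y + (1 - m) ^ k * x"
    by (subst (3 4) k) (simp only: power_Suc mult.assoc)
  finally have mem: "m ^ k * y + (1 - m) ^ k * x \<in> T" .
  have "[m ^ k * y + (1 - m) ^ k * x = 1 * y + 1 * x] (mod int n)"
    unfolding k_def
    by (intro cong_add cong_mult cong_refl euler_theorem_int n_gt_1 coprime_m coprime_1_minus_m)
  then show ?thesis
    using periodic[OF mem] by (simp add: add.commute)
qed

lemma affine_closed_minus:
  assumes "x \<in> T"
  shows "- x \<in> T"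
proof -
  have "int k * x \<in> T" for k
  proof (induction k)
    case (Suc k)
    then show ?case
      using affine_closed_add[OF assms Suc] by (simp add: algebra_simps)
  qed (simp add: zero_mem)
  then have "int (n - 1) * x \<in> T" .
  moreover have "[int (n - 1) * x = - x] (mod int n)"
    using n_gt_1 by (simp add: of_nat_diff cong_iff_dvd_diff algebra_simps)
  ultimately show ?thesis
    by (rule periodic)
qed

end

section \<open>Parity by reflection\<close>

text \<open>Counting modulo two is summing the constant \<open>1\<close> in the two-element field.\<close>

lemma even_card_involution:
  assumes "\<And>x. x \<in> X \<Longrightarrow> h x \<in> X" "\<And>x. x \<in> X \<Longrightarrow> h (h x) = x" "\<And>x. x \<in> X \<Longrightarrow> h x \<noteq> x"
  shows "even (card X)"
proof -
  have "(\<Sum>x\<in>X. (1 :: bit)) = 0"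
    by (rule sum_involution_eq_0[where h = h]) (use assms in auto)
  then have "even (of_nat (card X) :: bit)"
    by simp
  then show ?thesis
    by (simp only: even_of_nat_iff)
qed

lemma cong_atLeastAtMost_eq:
  assumes "i \<in> {1..n}" "j \<in> {1..n}" "[int i = int j] (mod int n)"
  shows "i = j"
proof -
  have "int n dvd int i - int j"
    using assms(3) by (simp add: cong_iff_dvd_diff)
  moreover have "\<bar>int i - int j\<bar> < int n"
    using assms(1,2) by auto
  ultimately show ?thesis
    using dvd_imp_le_int[of "int i - int j" "int n"] by auto
qed

lemma odd_card_if_affine_closed:
  fixes m :: int
  assumes S: "S \<subseteq> {1..n}" "S \<noteq> {}"
    and n: "n > 1" "odd n"
    and units: "coprime m (int n)" "coprime (1 - m) (int n)"
    and closed: "\<And>i j. \<lbrakk>i \<in> S; j \<in> S\<rbrakk> \<Longrightarrow> \<exists>s\<in>S. [int s = m * int j + (1 - m) * int i] (mod int n)"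
  shows "odd (card S)"
proof -
  obtain c where c: "c \<in> S"
    using S by blast
  \<comment> \<open>the translate of \<open>S\<close> that moves \<open>c\<close> to \<open>0\<close>\<close>
  define T where "T = {x. \<exists>i\<in>S. [x + int c = int i] (mod int n)}"
  interpret affine_closed n m T
  proof
    show "0 \<in> T"
      using c by (auto simp: T_def intro: bexI[of _ c])
  next
    fix x y assume "x \<in> T" "[x = y] (mod int n)"
    then show "y \<in> T"
      unfolding T_def by (blast intro: cong_trans cong_sym cong_add cong_refl)
  next
    fix x y assume "x \<in> T" "y \<in> T"
    then obtain i j where ij: "i \<in> S" "j \<in> S"
      "[x + int c = int i] (mod int n)" "[y + int c = int j] (mod int n)"
      by (auto simp: T_def)
    obtain s where s: "s \<in> S" "[int s = m * int j + (1 - m) * int i] (mod int n)"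
      using closed ij by blast
    have "[m * (y + int c) + (1 - m) * (x + int c) = m * int j + (1 - m) * int i] (mod int n)"
      by (intro cong_add cong_mult ij cong_refl)
    also have "[m * int j + (1 - m) * int i = int s] (mod int n)"
      using s by (simp add: cong_sym)
    also have "m * (y + int c) + (1 - m) * (x + int c) = (m * y + (1 - m) * x) + int c"
      by (simp add: algebra_simps)
    finally show "m * y + (1 - m) * x \<in> T"
      using s by (auto simp: T_def)
  qed (use n units in auto)
  have "\<exists>j\<in>S. [2 * int c - int i = int j] (mod int n)" if "i \<in> S" for i
  proof -
    have "int i - int c \<in> T"
      using that by (auto simp: T_def intro: bexI[of _ i])
    then have "- (int i - int c) \<in> T"
      by (rule affine_closed_minus)
    then show ?thesis
      by (simp add: T_def algebra_simps)
  qed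
  then obtain h where h: "\<And>i. i \<in> S \<Longrightarrow> h i \<in> S"
    "\<And>i. i \<in> S \<Longrightarrow> [2 * int c - int i = int (h i)] (mod int n)"
    by metis
  have h_h: "h (h i) = i" if "i \<in> S" for i
  proof (rule cong_atLeastAtMost_eq[where n = n])
    have "[2 * int c - int (h i) = int (h (h i))] (mod int n)"
      using h that by blast
    moreover have "[2 * int c - int (h i) = 2 * int c - (2 * int c - int i)] (mod int n)"
      by (intro cong_diff cong_refl cong_sym[OF h(2)] that)
    ultimately show "[int (h (h i)) = int i] (mod int n)"
      by (simp add: cong_def)
  qed (use h S that in blast)+
  have fixed: "i = c" if "i \<in> S" "h i = i" for i
  proof (rule cong_atLeastAtMost_eq[where n = n])
    have "int n dvd 2 * (int c - int i)"
      using h(2)[OF that(1)] that(2) by (simp add: cong_iff_dvd_diff algebra_simps)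
    moreover have "coprime (int n) 2"
      using n by simp
    ultimately have "int n dvd int c - int i"
      using coprime_dvd_mult_right_iff by blast
    then show "[int i = int c] (mod int n)"
      by (metis cong_iff_dvd_diff cong_sym)
  qed (use c S that in blast)+
  have "h c = c"
  proof (rule cong_atLeastAtMost_eq[where n = n])
    show "[int (h c) = int c] (mod int n)"
      using h(2)[OF c] by (simp add: cong_sym)
  qed (use c h S in blast)+
  have "even (card (S - {c}))"
  proof (rule even_card_involution)
    fix i assume i: "i \<in> S - {c}"
    then have "h i \<noteq> c"
      using h_h[of i] \<open>h c = c\<close> by auto
    then show "h i \<in> S - {c}"
      using h(1) i by simp
    show "h (h i) = i"
      using h_h i by simp
    show "h i \<noteq> i"
      using fixed i by blast
  qed
  moreover have "finite S"
    using S by (blast intro: finite_subset)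
  ultimately show ?thesis
    using card.remove[OF _ c] by simp
qed

section \<open>Subloops of \<open>L n m\<close>\<close>

lemma ex1_cong_atLeastAtMost:
  fixes x :: int
  assumes "n > 0"
  shows "\<exists>!s. s \<in> {1..n} \<and> [int s = x] (mod int n)"
proof -
  \<comment> \<open>shifting by one moves the window \<open>0..n-1\<close> of remainders to \<open>1..n\<close>\<close>
  define s where "s = nat ((x - 1) mod int n) + 1"
  have "int s = (x - 1) mod int n + 1"
    using assms by (simp add: s_def)
  then have "[int s = x] (mod int n)"
    by (simp add: cong_def mod_simps)
  moreover have "s \<in> {1..n}"
    using assms by (simp add: s_def Suc_le_eq nat_less_iff)
  ultimately show ?thesis
    by (metis cong_atLeastAtMost_eq cong_trans cong_sym)
qed

lemma L_mult_Num:
  assumes "n > 0" "i \<noteq> j"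
  obtains s where "L_mult n m (Num i) (Num j) = Num s"
    "[int s = int m * int j + (1 - int m) * int i] (mod int n)"
proof -
  let ?P = "\<lambda>s. s \<in> {1..n} \<and> [int s = int m * int j - (int m - 1) * int i] (mod int n)"
  have "?P (THE s. ?P s)"
    by (rule theI') (rule ex1_cong_atLeastAtMost[OF assms(1)])
  then show thesis
    using assms(2) by (intro that[of "THE s. ?P s"]) (simp_all add: algebra_simps)
qed

lemma even_card_subloop:
  assumes n: "n > 1" "odd n" and m: "0 < m"
    and units: "gcd m n = 1" "gcd (m - 1) n = 1"
    and P: "subloop P (L n m)" "card P \<noteq> 1"
  shows "even (card P)"
proof -
  define S where "S = {i. Num i \<in> P}"
  interpret P: algebraic_loop "(L n m)\<lparr>carrier := P\<rparr>"
    using P by (simp add: subloop_def)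
  have sub: "P \<subseteq> insert E (Num ` {1..n})"
    using P by (simp add: subloop_def L_def)
  have E: "E \<in> P"
    using P.one_closed by (simp add: L_def)
  have S: "S \<subseteq> {1..n}"
    using sub by (auto simp: S_def)
  have P_eq: "P = insert E (Num ` S)"
    using sub E by (auto simp: S_def)
  have "finite S"
    using S by (rule finite_subset) simp
  then have card_P: "card P = Suc (card S)"
    unfolding P_eq by (subst card_insert_disjoint) (auto simp: card_image inj_on_def)
  have closed: "\<exists>s\<in>S. [int s = int m * int j + (1 - int m) * int i] (mod int n)"
    if "i \<in> S" "j \<in> S" for i j
  proof (cases "i = j")
    case True
    then show ?thesis
      using that by (intro bexI[of _ i]) (simp_all add: algebra_simps)
  next
    case False
    obtain s where s: "L_mult n m (Num i) (Num j) = Num s"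
      "[int s = int m * int j + (1 - int m) * int i] (mod int n)"
      using L_mult_Num[of n i j m] False n by auto
    then have "Num s \<in> P"
      using P.closed[of "Num i" "Num j"] that by (simp add: S_def L_def)
    then show ?thesis
      using s by (auto simp: S_def)
  qed
  have "coprime (int m) (int n)"
    using units(1) by (simp add: coprime_iff_gcd_eq_1)
  moreover have "coprime (1 - int m) (int n)"
  proof -
    have "coprime (int (m - 1)) (int n)"
      unfolding coprime_int_iff using units(2) by (simp add: coprime_iff_gcd_eq_1)
    then have "coprime (- int (m - 1)) (int n)"
      by simp
    then show ?thesis
      using m by (simp add: of_nat_diff)
  qed
  moreover have "S \<noteq> {}"
    using P(2) card_P by auto
  ultimately have "odd (card S)"
    using S n closed by (intro odd_card_if_affine_closed[where m = "int m"])
  then show ?thesis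
    by (simp add: card_P)
qed

lemma card_with_I: "card (with_I P) = 2 * card P"
proof (cases "finite P")
  case True
  then show ?thesis
    unfolding with_I_def
    by (subst card_Un_disjoint) (auto simp: card_image inj_on_def)
next
  case False
  then have "infinite (with_I P)"
    by (simp add: with_I_def finite_image_iff inj_on_def)
  with False show ?thesis
    by simp
qed

theorem theorem4p1p6:
  fixes n m p :: nat
  assumes "n > 3" and "odd n"
    and "0 < m" and "m < n"
    and "gcd m n = 1" and "gcd (m - 1) n = 1"
    and "prime p" and "p dvd n + 1"
    and "\<exists>Q. sylow_neutro_subloop p n m Q"
  shows "p = 2"
proof -
  obtain P k where P: "subloop P (L n m)" and k: "k \<ge> 1" and card: "card (with_I P) = 2 * p ^ k"
    using assms(9) by (auto simp: sylow_neutro_subloop_def neutro_subloop_def)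
  have card_P: "card P = p ^ k"
    using card by (simp add: card_with_I)
  have "p ^ k \<noteq> 1"
    using k prime_gt_1_nat[OF assms(7)] by simp
  then have "even (card P)"
    using assms P card_P by (intro even_card_subloop[of n m]) auto
  then have "2 dvd p"
    by (simp add: card_P)
  then show ?thesis
    using primes_dvd_imp_eq[OF two_is_prime_nat assms(7)] by simp
qed

end
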